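(* Let $\sigma$ be a complex polynomial of degree $\le2$, $\sigma\neq0$, with $\sigma(0)=0$, let $\kappa$ be a complex polynomial of degree $\le1$, and let $\omega\in\mathbb{C}$. There exists a unique formal power series $F(z)$ solving $$\big(\mathcal{H}(\sigma,\kappa)+\omega\big)F(z)=0,\qquad F(0)=1.$$ It is equal to $$F(\sigma,\kappa,\omega;z)=\sum_{n=0}^\infty\frac{\prod_{j=0}^{n-1}\big(\omega+(j+\frac12)\kappa'+j(j+1)\frac{\sigma''}{2}\big)}{\prod_{j=0}^{n-1}\big(\kappa(0)+(j+1)\sigma'(0)\big)\,n!}(-z)^n .$$
   Context: $$\mathcal{H}(\sigma,\kappa):=\sigma(z)\partial_z^2+\big(\sigma'(z)+\kappa(z)\big)\partial_z+\tfrac12\kappa'.$$ Here $\sigma''$ and $\kappa'$ are constants, since $\deg\sigma\le2$ and $\deg\kappa\le1$. The function $F(\sigma,\kappa,\omega;z)$ is called the unified hypergeometric function; it is regarded as depending meromorphically on the parameters $\sigma'(0),\sigma'',\kappa,\omega$.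
   Formalization: The formal theorem additionally assumes κ(0)+(j+1)σ'(0)≠0 for all integers j≥0, i.e. that no denominator of the series vanishes; otherwise the claim fails, e.g. σ=z, κ=−1, ω=1 has no solution with F(0)=1. *)

theory Defs
  imports
    Complex_Main
    "HOL-Computational_Algebra.Formal_Power_Series"
    "HOL-Computational_Algebra.Polynomial_FPS"
begin

definition hyp_op :: "complex poly \<Rightarrow> complex poly \<Rightarrow> complex fps \<Rightarrow> complex fps" where
  "hyp_op \<sigma> \<kappa> F =
     fps_of_poly \<sigma> * fps_deriv (fps_deriv F)
     + fps_of_poly (pderiv \<sigma> + \<kappa>) * fps_deriv F
     + fps_of_poly (smult (1/2) (pderiv \<kappa>)) * F"

text \<open>
  For \<open>degree \<sigma> \<le> 2\<close> and \<open>degree \<kappa> \<le> 1\<close> the polynomials \<open>\<sigma>''\<close> and \<open>\<kappa>'\<close> are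
  constant, so they are identified with their values at \<open>0\<close>.
  The factor \<open>(- 1) ^ n\<close> comes from writing the series in powers of \<open>- z\<close>.
  The coefficients are rational functions of \<open>\<sigma>'(0)\<close>, \<open>\<sigma>''\<close>, \<open>\<kappa>(0)\<close>, \<open>\<kappa>'\<close>, \<open>\<omega>\<close>; the
  series is meaningful only where \<open>\<kappa>(0) + (j + 1) \<sigma>'(0) \<noteq> 0\<close> for all natural \<open>j\<close>,
  i.e. off the polar set (elsewhere division by zero yields a junk value).
\<close>
definition hyp_F :: "complex poly \<Rightarrow> complex poly \<Rightarrow> complex \<Rightarrow> complex fps" where
  "hyp_F \<sigma> \<kappa> \<omega> = Abs_fps (\<lambda>n.
     (\<Prod>j<n. \<omega> + (of_nat j + 1/2) * poly (pderiv \<kappa>) 0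
              + of_nat j * (of_nat j + 1) * (poly (pderiv (pderiv \<sigma>)) 0 / 2))
     / ((\<Prod>j<n. poly \<kappa> 0 + (of_nat j + 1) * poly (pderiv \<sigma>) 0) * fact n)
     * (- 1) ^ n)"

end

(* The equation is a two-term recurrence for the coefficients of F, whose leading factor
   (n + 1) (kappa(0) + (n + 1) sigma'(0)) never vanishes off the polar set; so F(0) = 1
   determines F, and the quotient of products solves the recurrence. *)
theory Submission imports Defs begin

text \<open>With \<sigma> = a z + b z^2, so that b is half of \<sigma>'', collect the contributions
  to z^n. The terms a z F'' and (a + c) F' give (n + 1) (n a + a + c); the terms b z^2 F'', (2 b +
  d) z F' and d/2 F give b n (n - 1) + (2 b + d) n + d/2, and n (n - 1) + 2 n = n (n + 1).\<close>

lemma hyp_op_nth: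
  "fps_nth (hyp_op [:0, a, b:] [:c, d:] F + fps_const \<omega> * F) n =
     of_nat (n + 1) * (c + (of_nat n + 1) * a) * fps_nth F (n + 1)
     + (\<omega> + (of_nat n + 1/2) * d + of_nat n * (of_nat n + 1) * b) * fps_nth F n"
proof -
  have *: "hyp_op [:0, a, b:] [:c, d:] F =
      fps_X * (fps_const a * fps_deriv (fps_deriv F))
      + fps_X * (fps_X * (fps_const b * fps_deriv (fps_deriv F)))
      + fps_const (a + c) * fps_deriv F + fps_X * (fps_const (2 * b + d) * fps_deriv F)
      + fps_const (d / 2) * F"
    by (simp add: hyp_op_def fps_of_poly_pCons pderiv_pCons algebra_simps
        flip: fps_const_add)
  show ?thesis
  proof (cases n)
    case 0
    then show ?thesis by (simp add: * algebra_simps)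
  next
    case (Suc m)
    \<comment> \<open>The factor z^2 shifts indices by two, so n = 1 has to be separated from n
      \<ge> 2.\<close>
    then show ?thesis by (cases m) (simp_all add: * algebra_simps)
  qed
qed

lemma poly_degree_le_1_eq: "degree p \<le> 1 \<Longrightarrow> p = [:coeff p 0, coeff p 1:]"
  by (rule poly_eqI) (auto simp: coeff_pCons coeff_eq_0 split: nat.split)

lemma poly_degree_le_2_eq: "degree p \<le> 2 \<Longrightarrow> p = [:coeff p 0, coeff p 1, coeff p 2:]"
  by (rule poly_eqI) (auto simp: coeff_pCons coeff_eq_0 numeral_2_eq_2 split: nat.split)

lemma fps_recurrence_unique:
  fixes p q :: "nat \<Rightarrow> 'a :: field"
  assumes "\<And>n. p n \<noteq> 0"
    and "\<And>n. p n * fps_nth F (n + 1) + q n * fps_nth F n = 0"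
    and "\<And>n. p n * fps_nth G (n + 1) + q n * fps_nth G n = 0"
    and "fps_nth F 0 = fps_nth G 0"
  shows "F = G"
proof (rule fps_ext)
  fix n show "fps_nth F n = fps_nth G n"
  proof (induction n)
    case 0
    then show ?case by (rule assms(4))
  next
    case (Suc n)
    have "p n * fps_nth F (n + 1) = p n * fps_nth G (n + 1)"
      using assms(2)[of n] assms(3)[of n] Suc by (metis add_right_cancel)
    then show ?case using assms(1)[of n] by simp
  qed
qed

theorem theorem4p1:
  fixes \<sigma> \<kappa> :: "complex poly" and \<omega> :: complex
  assumes "degree \<sigma> \<le> 2" and "\<sigma> \<noteq> 0" and "poly \<sigma> 0 = 0"
    and "degree \<kappa> \<le> 1"
    and "\<And>j::nat. poly \<kappa> 0 + (of_nat j + 1) * poly (pderiv \<sigma>) 0 \<noteq> 0"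
  shows "(\<exists>!F. hyp_op \<sigma> \<kappa> F + fps_const \<omega> * F = 0 \<and> fps_nth F 0 = 1)
    \<and> (\<forall>F. hyp_op \<sigma> \<kappa> F + fps_const \<omega> * F = 0 \<and> fps_nth F 0 = 1 \<longrightarrow> F = hyp_F \<sigma> \<kappa> \<omega>)"
proof -
  \<comment> \<open>The condition \<sigma>(0) = 0 keeps the recurrence two-term: a constant term of
    \<sigma> would bring in the coefficient of index n + 2.\<close>
  obtain a b where \<sigma>: "\<sigma> = [:0, a, b:]"
    using poly_degree_le_2_eq[OF assms(1)] assms(3) by (metis poly_0_coeff_0)
  obtain c d where \<kappa>: "\<kappa> = [:c, d:]"
    using poly_degree_le_1_eq[OF assms(4)] by blast
  define p where "p n = of_nat (n + 1) * (c + (of_nat n + 1) * a)" for n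
  define q where "q n = \<omega> + (of_nat n + 1/2) * d + of_nat n * (of_nat n + 1) * b" for n
  have nz: "c + (of_nat n + 1) * a \<noteq> 0" for n
    using assms(5)[of n] by (simp add: \<sigma> \<kappa> pderiv_pCons)
  have p_nz: "p n \<noteq> 0" for n
    using nz[of n] unfolding p_def by (metis mult_eq_0_iff of_nat_eq_0_iff Suc_eq_plus1 nat.distinct(2))
  have eq_iff: "hyp_op \<sigma> \<kappa> F + fps_const \<omega> * F = 0
      \<longleftrightarrow> (\<forall>n. p n * fps_nth F (n + 1) + q n * fps_nth F n = 0)" for F
    unfolding fps_eq_iff \<sigma> \<kappa> hyp_op_nth p_def q_def by simp
  let ?H = "hyp_F \<sigma> \<kappa> \<omega>"
  have H_nth: "fps_nth ?H n =
      (\<Prod>j<n. q j) / ((\<Prod>j<n. c + (of_nat j + 1) * a) * fact n) * (- 1) ^ n" for n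
    by (simp add: hyp_F_def \<sigma> \<kappa> q_def pderiv_pCons)
  have H_rec: "p n * fps_nth ?H (n + 1) + q n * fps_nth ?H n = 0" for n
  proof -
    define P where "P = (\<Prod>j<n. c + (of_nat j + 1) * a)"
    define Q where "Q = (\<Prod>j<n. q j)"
    \<comment> \<open>Each product gains one factor. The new denominator factors c + (n + 1) a and n
      + 1, the latter from the factorial, combine to \<open>p n\<close>, and the extra -1 gives the
      sign that the recurrence requires.\<close>
    have "fps_nth ?H (n + 1) =
        (Q * q n) / ((P * (c + (of_nat n + 1) * a)) * (of_nat (n + 1) * fact n)) * (- 1) ^ (n + 1)"
      by (simp only: H_nth P_def Q_def Suc_eq_plus1[symmetric] prod.lessThan_Suc fact_Suc)
    also have "\<dots> = - (Q * q n * (- 1) ^ n) / (P * fact n * p n)"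
      by (simp add: p_def mult_ac)
    finally have "p n * fps_nth ?H (n + 1) = - (q n * (Q / (P * fact n) * (- 1) ^ n))"
      using p_nz[of n] by (simp only:) (simp add: mult_ac)
    then show ?thesis
      by (simp only: H_nth[of n] P_def Q_def) simp
  qed
  have H: "hyp_op \<sigma> \<kappa> ?H + fps_const \<omega> * ?H = 0 \<and> fps_nth ?H 0 = 1"
    using H_rec eq_iff by (simp add: H_nth)
  \<comment> \<open>Comparing every solution with the explicit series \<open>?H\<close> gives
    uniqueness and the closed form at once.\<close>
  have "F = ?H" if "hyp_op \<sigma> \<kappa> F + fps_const \<omega> * F = 0 \<and> fps_nth F 0 = 1" for F
    using fps_recurrence_unique[of p F q ?H] p_nz H_rec H that eq_iff by metis
  with H show ?thesis by blast
qed

end
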